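(* Let $(n,m)\in\{(3,3),(4,3),(5,3),(3,4),(3,5)\}$. Then $H_1(\mathcal{N}_n(\sigma_1^m);\mathbb{Z})$ is torsion free of finite rank, namely free abelian of rank $4$ if $(n,m)=(3,3)$, rank $6$ if $(n,m)=(3,4)$, rank $12$ if $(n,m)=(3,5)$, rank $12$ if $(n,m)=(4,3)$, and rank $40$ if $(n,m)=(5,3)$.
   Context: $B_n$ denotes the Artin braid group with standard generators $\sigma_1,\dots,\sigma_{n-1}$ (relations $\sigma_i\sigma_j=\sigma_j\sigma_i$ for $|i-j|>1$ and $\sigma_i\sigma_j\sigma_i=\sigma_j\sigma_i\sigma_j$ for $|i-j|=1$), and $\mathcal{N}_n(\sigma_1^m)$ denotes the normal closure of $\sigma_1^m$ in $B_n$. $H_1(G;\mathbb{Z})$ is the abelianization of $G$. *)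

theory Defs
  imports "HOL-Algebra.Algebra"
begin

text \<open>Artin braid group B_n given by its standard presentation.
  A letter (i, True) stands for sigma_i, (i, False) for sigma_i inverse.\<close>

type_synonym braid_word = "(nat \<times> bool) list"

definition braid_words :: "nat \<Rightarrow> braid_word set" where
  "braid_words n = {w. \<forall>(i, b) \<in> set w. 1 \<le> i \<and> i \<le> n - 1}"

inductive braid_eq :: "nat \<Rightarrow> braid_word \<Rightarrow> braid_word \<Rightarrow> bool" for n where
  br_refl: "w \<in> braid_words n \<Longrightarrow> braid_eq n w w"
| br_sym: "braid_eq n u v \<Longrightarrow> braid_eq n v u"
| br_trans: "braid_eq n u v \<Longrightarrow> braid_eq n v w \<Longrightarrow> braid_eq n u w"
| br_cancel: "u \<in> braid_words n \<Longrightarrow> v \<in> braid_words n \<Longrightarrow> 1 \<le> i \<Longrightarrow> i \<le> n - 1 \<Longrightarrow>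
    braid_eq n (u @ [(i, b), (i, \<not> b)] @ v) (u @ v)"
| br_comm: "u \<in> braid_words n \<Longrightarrow> v \<in> braid_words n \<Longrightarrow> 1 \<le> i \<Longrightarrow> i \<le> n - 1 \<Longrightarrow>
    1 \<le> j \<Longrightarrow> j \<le> n - 1 \<Longrightarrow> i + 1 < j \<or> j + 1 < i \<Longrightarrow>
    braid_eq n (u @ [(i, True), (j, True)] @ v) (u @ [(j, True), (i, True)] @ v)"
| br_braid: "u \<in> braid_words n \<Longrightarrow> v \<in> braid_words n \<Longrightarrow> 1 \<le> i \<Longrightarrow> i \<le> n - 1 \<Longrightarrow>
    1 \<le> j \<Longrightarrow> j \<le> n - 1 \<Longrightarrow> i + 1 = j \<or> j + 1 = i \<Longrightarrow>
    braid_eq n (u @ [(i, True), (j, True), (i, True)] @ v) (u @ [(j, True), (i, True), (j, True)] @ v)"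

definition braid_rel :: "nat \<Rightarrow> (braid_word \<times> braid_word) set" where
  "braid_rel n = {(u, v). braid_eq n u v}"

definition braid_group :: "nat \<Rightarrow> braid_word set monoid" where
  "braid_group n =
    \<lparr> carrier = braid_words n // braid_rel n,
      monoid.mult = (\<lambda>A B. braid_rel n `` {(SOME a. a \<in> A) @ (SOME b. b \<in> B)}),
      monoid.one = braid_rel n `` {[]} \<rparr>"

definition braid_gen :: "nat \<Rightarrow> nat \<Rightarrow> braid_word set" where
  "braid_gen n i = braid_rel n `` {[(i, True)]}"

definition normal_closure :: "('a, 'b) monoid_scheme \<Rightarrow> 'a set \<Rightarrow> 'a set" where
  "normal_closure G S =
     generate G (\<Union>g \<in> carrier G. (\<lambda>s. g \<otimes>\<^bsub>G\<^esub> s \<otimes>\<^bsub>G\<^esub> inv\<^bsub>G\<^esub> g) ` S)"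

definition abelianization :: "('a, 'b) monoid_scheme \<Rightarrow> 'a set monoid" where
  "abelianization G = G Mod derived G (carrier G)"

definition H1_N :: "nat \<Rightarrow> nat \<Rightarrow> braid_word set set monoid" where
  "H1_N n m = abelianization
     (subgroup_generated (braid_group n)
        (normal_closure (braid_group n) {braid_gen n 1 [^]\<^bsub>braid_group n\<^esub> m}))"

end

theory Submission
  imports Defs
begin

text \<open>Let \<open>N\<close> be the normal closure of \<open>\<sigma>\<^sub>1\<^sup>m\<close>. Conjugation turns \<open>H\<^sub>1(N)\<close> into a module over the finite
  group \<open>B\<^sub>n/N\<close>, generated by the class of \<open>\<sigma>\<^sub>1\<^sup>m\<close>. That class is fixed by \<open>\<sigma>\<^sub>1, \<sigma>\<^sub>3, \<dots>, \<sigma>\<^bsub>n-1\<^esub>\<close> and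
  \<open>\<sigma>\<^sub>2\<sigma>\<^sub>1\<^sup>2\<sigma>\<^sub>2\<close>, and a coset enumeration shows that these relations leave an orbit of at most \<open>k\<close>
  elements \<open>y\<^sub>i\<close>, where \<open>k\<close> is the number of mirrors of the complex reflection group \<open>B\<^sub>n/N\<close>. So
  \<open>H\<^sub>1(N)\<close> is a quotient of \<open>\<int>\<^sup>k\<close>.

  For independence, suitable integer weights on the edges of the Schreier graph of this orbit make
  \<open>B\<^sub>n\<close> act on \<open>{0..<k} \<times> \<int>\<close>, commuting with translations of the second factor. There \<open>N\<close> acts by
  translating each fibre separately, which gives a homomorphism \<open>N \<rightarrow> \<int>\<^sup>k\<close>, and it sends \<open>y\<^sub>i\<close> to \<open>d\<close> times
  the \<open>i\<close>-th basis vector with \<open>d \<noteq> 0\<close>.\<close>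

subsection \<open>The braid group\<close>

abbreviation braid_class :: "nat \<Rightarrow> braid_word \<Rightarrow> braid_word set" where
  "braid_class n w \<equiv> braid_rel n `` {w}"

lemma braid_words_Nil [simp]: "[] \<in> braid_words n"
  by (simp add: braid_words_def)

lemma braid_words_Cons [simp]:
  "a # w \<in> braid_words n \<longleftrightarrow> 1 \<le> fst a \<and> fst a < n \<and> w \<in> braid_words n"
  by (auto simp: braid_words_def)

lemma braid_words_append [simp]:
  "u @ v \<in> braid_words n \<longleftrightarrow> u \<in> braid_words n \<and> v \<in> braid_words n"
  by (auto simp: braid_words_def)

lemma braid_eq_words: "braid_eq n u v \<Longrightarrow> u \<in> braid_words n \<and> v \<in> braid_words n"
  by (induction rule: braid_eq.induct) auto

lemma braid_eq_context:
  assumes "braid_eq n u v" "x \<in> braid_words n" "y \<in> braid_words n"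
  shows "braid_eq n (x @ u @ y) (x @ v @ y)"
  using assms(1)
proof (induction rule: braid_eq.induct)
  case (br_refl w)
  then show ?case using assms by (intro braid_eq.br_refl) auto
next
  case (br_sym u v)
  then show ?case by (blast intro: braid_eq.br_sym)
next
  case (br_trans u v w)
  then show ?case by (blast intro: braid_eq.br_trans)
next
  case (br_cancel u v i b)
  then show ?case
    using braid_eq.br_cancel[of "x @ u" n "v @ y" i b] assms by simp
next
  case (br_comm u v i j)
  then show ?case
    using braid_eq.br_comm[of "x @ u" n "v @ y" i j] assms by simp
next
  case (br_braid u v i j)
  then show ?case
    using braid_eq.br_braid[of "x @ u" n "v @ y" i j] assms by simp
qed

lemma braid_eq_append:
  assumes "braid_eq n u u'" "braid_eq n v v'"
  shows "braid_eq n (u @ v) (u' @ v')"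
proof -
  have "braid_eq n (u @ v) (u' @ v)"
    using braid_eq_context[OF assms(1), of "[]" v] braid_eq_words[OF assms(2)] by simp
  moreover have "braid_eq n (u' @ v) (u' @ v')"
    using braid_eq_context[OF assms(2), of u' "[]"] braid_eq_words[OF assms(1)] by simp
  ultimately show ?thesis by (rule br_trans)
qed

lemma equiv_braid_rel: "equiv (braid_words n) (braid_rel n)"
  unfolding equiv_def refl_on_def sym_def trans_def braid_rel_def
  by (auto dest: braid_eq_words intro: br_refl br_sym br_trans)

lemma braid_class_eq_iff:
  "u \<in> braid_words n \<Longrightarrow> v \<in> braid_words n \<Longrightarrow> braid_class n u = braid_class n v \<longleftrightarrow> braid_eq n u v"
  using eq_equiv_class_iff[OF equiv_braid_rel] by (simp add: braid_rel_def)

text \<open>Multiplication in \<open>braid_group\<close> picks representatives with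
  \<open>SOME\<close>; this makes the product independent of the choice.\<close>

lemma braid_eq_some_in_class:
  assumes "u \<in> braid_words n"
  shows "braid_eq n u (SOME a. a \<in> braid_class n u)"
proof -
  have "u \<in> braid_class n u"
    using assms by (simp add: braid_rel_def br_refl)
  then have "(SOME a. a \<in> braid_class n u) \<in> braid_class n u"
    by (rule someI)
  then show ?thesis by (simp add: braid_rel_def)
qed

lemma carrier_braid_group: "carrier (braid_group n) = braid_class n ` braid_words n"
  by (auto simp: braid_group_def quotient_def)

lemma braid_class_in_carrier [simp]:
  "w \<in> braid_words n \<Longrightarrow> braid_class n w \<in> carrier (braid_group n)"
  by (simp add: carrier_braid_group)

lemma one_braid_group: "\<one>\<^bsub>braid_group n\<^esub> = braid_class n []"
  by (simp add: braid_group_def)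

lemma braid_class_append:
  assumes "u \<in> braid_words n" "v \<in> braid_words n"
  shows "braid_class n (u @ v) = braid_class n u \<otimes>\<^bsub>braid_group n\<^esub> braid_class n v"
proof -
  let ?a = "SOME a. a \<in> braid_class n u" and ?b = "SOME b. b \<in> braid_class n v"
  have "braid_eq n (u @ v) (?a @ ?b)"
    by (intro braid_eq_append braid_eq_some_in_class assms)
  then have "braid_class n (u @ v) = braid_class n (?a @ ?b)"
    using braid_class_eq_iff braid_eq_words by blast
  then show ?thesis by (simp add: braid_group_def)
qed

definition inverse_word :: "braid_word \<Rightarrow> braid_word" where
  "inverse_word w = rev (map (\<lambda>(i, b). (i, \<not> b)) w)"

lemma inverse_word_in_braid_words [simp]:
  "inverse_word w \<in> braid_words n \<longleftrightarrow> w \<in> braid_words n"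
  by (force simp: inverse_word_def braid_words_def)

lemma braid_eq_inverse_word:
  "w \<in> braid_words n \<Longrightarrow> braid_eq n (inverse_word w @ w) []"
proof (induction w)
  case Nil
  then show ?case by (simp add: inverse_word_def br_refl)
next
  case (Cons a w)
  obtain i b where a: "a = (i, b)" by fastforce
  have "braid_eq n (inverse_word w @ [(i, \<not> b), (i, \<not> \<not> b)] @ w) (inverse_word w @ w)"
    using Cons.prems a by (intro br_cancel) auto
  then show ?case
    using Cons a by (auto simp: inverse_word_def intro: br_trans)
qed

lemma group_braid_group: "group (braid_group n)"
proof (rule groupI)
  fix x y z
  assume "x \<in> carrier (braid_group n)" "y \<in> carrier (braid_group n)" "z \<in> carrier (braid_group n)"
  then show "x \<otimes>\<^bsub>braid_group n\<^esub> y \<otimes>\<^bsub>braid_group n\<^esub> z = x \<otimes>\<^bsub>braid_group n\<^esub> (y \<otimes>\<^bsub>braid_group n\<^esub> z)"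
    by (auto simp: carrier_braid_group simp flip: braid_class_append)
next
  fix x
  assume "x \<in> carrier (braid_group n)"
  then obtain w where w: "x = braid_class n w" "w \<in> braid_words n"
    by (auto simp: carrier_braid_group)
  then have "braid_class n (inverse_word w) \<otimes>\<^bsub>braid_group n\<^esub> x = \<one>\<^bsub>braid_group n\<^esub>"
    by (simp add: one_braid_group braid_class_eq_iff braid_eq_inverse_word flip: braid_class_append)
  then show "\<exists>y\<in>carrier (braid_group n). y \<otimes>\<^bsub>braid_group n\<^esub> x = \<one>\<^bsub>braid_group n\<^esub>"
    using w by (meson braid_class_in_carrier inverse_word_in_braid_words)
qed (auto simp: carrier_braid_group one_braid_group simp flip: braid_class_append)

interpretation braid: group "braid_group n" for n
  by (rule group_braid_group)

lemma braid_gen_pow: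
  assumes "1 \<le> j" "j \<le> n - 1"
  shows "braid_gen n j [^]\<^bsub>braid_group n\<^esub> (m::nat) = braid_class n (replicate m (j, True))"
proof (induction m)
  case 0
  then show ?case by (simp add: one_braid_group)
next
  case (Suc m)
  have "replicate m (j, True) \<in> braid_words n"
    using assms by (auto simp: braid_words_def)
  then show ?case
    using Suc assms by (simp add: braid_gen_def replicate_append_same flip: braid_class_append)
qed

section \<open>Actions of braid words by bijections\<close>

definition word_action :: "(nat \<Rightarrow> 'a \<Rightarrow> 'a) \<Rightarrow> braid_word \<Rightarrow> 'a \<Rightarrow> 'a" where
  "word_action f = foldr (\<lambda>(j, b). if b then f j else inv_into UNIV (f j))"

lemma word_action_simps [simp]:
  "word_action f [] x = x"
  "word_action f ((j, b) # w) x = (if b then f j else inv_into UNIV (f j)) (word_action f w x)"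
  by (simp_all add: word_action_def)

lemma word_action_append: "word_action f (u @ v) x = word_action f u (word_action f v x)"
  by (simp add: word_action_def)

text \<open>Bijectivity takes care of cancellation, \<open>comm\<close> and \<open>braid\<close> of
  the two relations. Each is assumed for one order of the indices, since swapping them only reverses
  the equation.\<close>

lemma word_action_cong:
  assumes "braid_eq n u v"
    and bij: "\<And>j. 1 \<le> j \<Longrightarrow> j \<le> n - 1 \<Longrightarrow> bij (f j)"
    and comm: "\<And>i j x. 1 \<le> i \<Longrightarrow> i + 1 < j \<Longrightarrow> j \<le> n - 1 \<Longrightarrow> f i (f j x) = f j (f i x)"
    and braid: "\<And>i x. 1 \<le> i \<Longrightarrow> i + 1 \<le> n - 1 \<Longrightarrow>
      f i (f (i + 1) (f i x)) = f (i + 1) (f i (f (i + 1) x))"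
  shows "word_action f u x = word_action f v x"
  using assms(1)
proof (induction arbitrary: x rule: braid_eq.induct)
  case (br_cancel u v i b)
  then show ?case
    using bij[of i] by (auto simp: word_action_append bij_is_inj bij_is_surj surj_f_inv_f)
next
  case (br_comm u v i j)
  then show ?case
    using comm[of i j] comm[of j i] by (auto simp: word_action_append)
next
  case (br_braid u v i j)
  then show ?case
    using braid[of i] braid[of j] by (auto simp: word_action_append)
qed auto

subsection \<open>Conjugation on the abelianization of a normal subgroup\<close>

text \<open>A homomorphism into a commutative group kills all commutators, hence is constant on the
  cosets of the derived subgroup.\<close>

lemma (in group) abelianization_universal:
  assumes "h \<in> hom G H" "comm_group H"
  obtains f where "f \<in> hom (abelianization G) H"
    "\<And>x. x \<in> carrier G \<Longrightarrow> f (derived G (carrier G) #> x) = h x"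
proof -
  interpret H: comm_group H by fact
  interpret h: group_hom G H h
    by unfold_locales (rule assms)
  interpret D: normal "derived G (carrier G)" G
    by (rule derived_self_is_normal)
  have "h ` derived G (carrier G) = {\<one>\<^bsub>H\<^esub>}"
    using h.derived_img[of "carrier G"] H.derived_eq_singleton[of "h ` carrier G"] h.hom_closed by blast
  then have ker: "h c = \<one>\<^bsub>H\<^esub>" if "c \<in> derived G (carrier G)" for c
    using that by blast
  have "h x = h y"
    if "x \<in> carrier G" "y \<in> carrier G" "derived G (carrier G) #> x = derived G (carrier G) #> y" for x y
  proof -
    have "x \<in> derived G (carrier G) #> y"
      using that rcos_self[OF _ D.subgroup_axioms] by blast
    then obtain c where "c \<in> derived G (carrier G)" "x = c \<otimes> y"
      by (auto simp: r_coset_def)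
    then show ?thesis
      using that ker D.subset by (simp add: subset_iff)
  qed
  with FactGroup_universal[OF assms(1) derived_self_is_normal] show ?thesis
    using that unfolding abelianization_def by blast
qed

text \<open>The generators give a surjection from Z^k, and the functionals recover each coordinate
  up to the factor \<open>d\<close>. A nonzero \<open>d\<close> already forces the kernel to be
  trivial.\<close>

lemma (in comm_group) isomorphic_free_Abelian_group_if_dual:
  fixes y :: "nat \<Rightarrow> 'a" and \<phi> :: "nat \<Rightarrow> 'a \<Rightarrow> int" and d :: int
  assumes y: "\<And>i. i < k \<Longrightarrow> y i \<in> carrier G"
    and gen: "carrier G \<subseteq> generate G (y ` {..<k})"
    and hom: "\<And>i. i < k \<Longrightarrow> \<phi> i \<in> hom G integer_group"
    and dual: "\<And>i j. i < k \<Longrightarrow> j < k \<Longrightarrow> \<phi> i (y j) = (if i = j then d else 0)"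
    and "d \<noteq> 0"
  shows "G \<cong> free_Abelian_group {..<k}"
proof -
  let ?F = "free_Abelian_group {..<k}"
  obtain h where h: "h \<in> hom ?F G" "\<And>i. i \<in> {..<k} \<Longrightarrow> h (frag_of i) = y i"
    using free_Abelian_group_universal[of y "{..<k}"] y by blast
  interpret h: group_hom ?F G h
    by (simp add: group_hom_def group_hom_axioms_def is_group h)
  \<comment> \<open>By induction over the free abelian group: zero, differences and basis
    elements.\<close>
  have coord: "\<phi> i (h x) = d * Poly_Mapping.lookup x i" if "i < k" "Poly_Mapping.keys x \<subseteq> {..<k}" for i x
  proof -
    interpret \<phi>: group_hom G integer_group "\<phi> i"
      by (simp add: group_hom_def group_hom_axioms_def is_group hom that)
    from that(2) show ?thesis
    proof (rule free_Abelian_group_induct)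
      show "\<phi> i (h 0) = d * Poly_Mapping.lookup 0 i"
        using h.hom_one \<phi>.hom_one by simp
    next
      fix a b
      assume ab: "Poly_Mapping.keys a \<subseteq> {..<k}" "Poly_Mapping.keys b \<subseteq> {..<k}"
        "\<phi> i (h a) = d * Poly_Mapping.lookup a i" "\<phi> i (h b) = d * Poly_Mapping.lookup b i"
      have "h (a - b) = h a \<otimes> inv h b"
        using h.hom_mult[of a "- b"] h.hom_inv[of b] ab by simp
      moreover have "h a \<in> carrier G" "h b \<in> carrier G"
        using ab h.hom_closed by auto
      ultimately show "\<phi> i (h (a - b)) = d * Poly_Mapping.lookup (a - b) i"
        using ab \<phi>.hom_inv by (simp add: Poly_Mapping.lookup_minus algebra_simps)
    next
      fix j assume "j \<in> {..<k}"
      then show "\<phi> i (h (frag_of j)) = d * Poly_Mapping.lookup (frag_of j) i"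
        using h(2) dual[OF \<open>i < k\<close>] by auto
    qed
  qed
  have "inj_on h (carrier ?F)"
  proof (rule h.inj_on_one_iff[THEN iffD2, rule_format])
    fix x assume x: "x \<in> carrier ?F" "h x = \<one>"
    have "Poly_Mapping.lookup x i = 0" for i
    proof (cases "i < k")
      case True
      interpret \<phi>: group_hom G integer_group "\<phi> i"
        by (simp add: group_hom_def group_hom_axioms_def is_group hom True)
      show ?thesis using coord[OF True, of x] x \<phi>.hom_one \<open>d \<noteq> 0\<close> by simp
    next
      case False
      then show ?thesis using x by (auto simp: in_keys_iff)
    qed
    then show "x = \<one>\<^bsub>?F\<^esub>" by (simp add: poly_mapping_eqI)
  qed
  moreover have "carrier G \<subseteq> h ` carrier ?F"
  proof -
    have "y ` {..<k} \<subseteq> h ` carrier ?F"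
      using h(2) by (auto intro!: image_eqI[of _ h, OF sym])
    then show ?thesis
      using gen generate_subgroup_incl[OF _ h.img_is_subgroup] by blast
  qed
  ultimately have "h \<in> iso ?F G"
    using h(1) h.hom_closed by (auto simp: iso_def bij_betw_def)
  then show ?thesis
    by (meson group_free_Abelian_group group.iso_sym is_isoI)
qed

text \<open>Conjugating a coset elementwise avoids choosing a representative.\<close>

definition conj_set :: "('a, 'b) monoid_scheme \<Rightarrow> 'a \<Rightarrow> 'a set \<Rightarrow> 'a set" where
  "conj_set G g C = (\<lambda>x. g \<otimes>\<^bsub>G\<^esub> x \<otimes>\<^bsub>G\<^esub> inv\<^bsub>G\<^esub> g) ` C"

lemma (in group) conj_set_mult:
  assumes "g \<in> carrier G" "h \<in> carrier G" "C \<subseteq> carrier G"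
  shows "conj_set G (g \<otimes> h) C = conj_set G g (conj_set G h C)"
  unfolding conj_set_def image_image
  using assms by (intro image_cong) (auto simp: m_assoc inv_mult_group subset_iff)

lemma (in group) conj_set_r_coset:
  assumes "D \<lhd> G" "g \<in> carrier G" "x \<in> carrier G"
  shows "conj_set G g (D #> x) = D #> (g \<otimes> x \<otimes> inv g)"
proof -
  interpret D: normal D G by fact
  have "conj_set G g (D #> x) \<subseteq> D #> (g \<otimes> x \<otimes> inv g)" if "g \<in> carrier G" "x \<in> carrier G" for g x
  proof
    fix w assume "w \<in> conj_set G g (D #> x)"
    then obtain c where c: "c \<in> D" "w = g \<otimes> (c \<otimes> x) \<otimes> inv g"
      by (auto simp: conj_set_def r_coset_def)
    then have cc: "c \<in> carrier G" using D.subset by blast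
    then have "w = (g \<otimes> c \<otimes> inv g) \<otimes> (g \<otimes> x \<otimes> inv g)"
      using c that by (simp add: m_assoc) (simp add: m_assoc[symmetric])
    then show "w \<in> D #> (g \<otimes> x \<otimes> inv g)"
      using D.inv_op_closed2[OF that(1) c(1)] by (auto simp: r_coset_def)
  qed
  note sub = this
  show ?thesis
  proof
    show "conj_set G g (D #> x) \<subseteq> D #> (g \<otimes> x \<otimes> inv g)"
      using sub assms by simp
    \<comment> \<open>The converse inclusion is \<open>sub\<close> for \<open>inv g\<close>,
      conjugated back by \<open>g\<close>.\<close>
    let ?x = "g \<otimes> x \<otimes> inv g"
    have cl: "?x \<in> carrier G" "D #> ?x \<subseteq> carrier G" using assms D.subset r_coset_subset_G by auto
    have "D #> ?x = conj_set G g (conj_set G (inv g) (D #> ?x))"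
      using cl assms conj_set_mult[of g "inv g" "D #> ?x"]
      by (force simp: conj_set_def)
    also have "\<dots> \<subseteq> conj_set G g (D #> (inv g \<otimes> ?x \<otimes> inv (inv g)))"
      using sub[of "inv g" ?x] assms cl by (auto simp: conj_set_def)
    also have "inv g \<otimes> ?x \<otimes> inv (inv g) = x"
      using assms by (simp add: m_assoc) (simp add: m_assoc[symmetric])
    finally show "D #> ?x \<subseteq> conj_set G g (D #> x)" .
  qed
qed

context group
begin

context
  fixes N assumes N: "N \<lhd> G"
begin

interpretation N: normal N G by (rule N)
interpretation D: normal "derived G N" G by (rule derived_is_normal[OF N])

lemma abelianization_normal_subgroup:
  "abelianization (subgroup_generated G N) = G\<lparr>carrier := N\<rparr> Mod derived G N"
proof -
  have "subgroup_generated G N = G\<lparr>carrier := N\<rparr>"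
    using N.carrier_subgroup_generated_subgroup N.subset
    by (simp add: subgroup_generated_def Int_absorb1)
  then show ?thesis
    by (simp add: abelianization_def derived_consistent N.subgroup_axioms)
qed

lemma carrier_abelianization_normal_subgroup:
  "carrier (abelianization (subgroup_generated G N)) = (\<lambda>x. derived G N #> x) ` N"
  by (auto simp: abelianization_normal_subgroup carrier_FactGroup r_coset_def)

lemma comm_group_abelianization_normal_subgroup:
  "comm_group (abelianization (subgroup_generated G N))"
  using group.derived_quot_is_comm_group[OF subgroup_imp_group[OF N.subgroup_axioms]]
  by (simp add: abelianization_normal_subgroup derived_consistent N.subgroup_axioms)

lemma r_coset_hom_abelianization:
  "(\<lambda>x. derived G N #> x) \<in> hom (G\<lparr>carrier := N\<rparr>) (abelianization (subgroup_generated G N))"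
  using carrier_abelianization_normal_subgroup D.rcos_sum N.subset
  by (auto simp: hom_def abelianization_normal_subgroup FactGroup_def set_mult_def subset_iff)

lemma conj_set_closed:
  assumes "g \<in> carrier G" "C \<in> carrier (abelianization (subgroup_generated G N))"
  shows "conj_set G g C \<in> carrier (abelianization (subgroup_generated G N))"
  using assms N.subset N.inv_op_closed2 conj_set_r_coset[OF D.normal_axioms]
  by (auto simp: carrier_abelianization_normal_subgroup)

text \<open>Here \<open>g x g^-1\<close> and \<open>x\<close> differ by a commutator of elements of
  \<open>N\<close>. Thus the conjugation action on the abelianization factors through the quotient
  by \<open>N\<close>.\<close>

lemma conj_set_trivial:
  assumes "g \<in> N" "C \<in> carrier (abelianization (subgroup_generated G N))"
  shows "conj_set G g C = C"
proof -
  obtain x where x: "x \<in> N" "C = derived G N #> x"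
    using assms carrier_abelianization_normal_subgroup by auto
  then have "x \<in> carrier G" "g \<in> carrier G" using assms N.subset by auto
  moreover have "g \<otimes> x \<otimes> inv g \<otimes> inv x \<in> derived G N"
    unfolding derived_def using assms x by (intro generate.incl) auto
  moreover have "g \<otimes> x \<otimes> inv g = (g \<otimes> x \<otimes> inv g \<otimes> inv x) \<otimes> x"
    using \<open>x \<in> carrier G\<close> \<open>g \<in> carrier G\<close> by (simp add: m_assoc)
  ultimately have "g \<otimes> x \<otimes> inv g \<in> derived G N #> x"
    unfolding r_coset_def by blast
  then have "derived G N #> (g \<otimes> x \<otimes> inv g) = derived G N #> x"
    using repr_independence[OF _ \<open>x \<in> carrier G\<close> D.subgroup_axioms] by simp
  then show ?thesis
    using x conj_set_r_coset[OF D.normal_axioms] \<open>x \<in> carrier G\<close> \<open>g \<in> carrier G\<close> by simp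
qed

lemma abelianization_normal_subgroup_subset:
  "C \<in> carrier (abelianization (subgroup_generated G N)) \<Longrightarrow> C \<subseteq> carrier G"
  using N.subset r_coset_subset_G[OF D.subset] by (auto simp: carrier_abelianization_normal_subgroup)

end

end

section \<open>Normal closures and conjugate powers\<close>

lemma (in group) normal_closure_normal:
  assumes "S \<subseteq> carrier G"
  shows "normal_closure G S \<lhd> G"
  unfolding normal_closure_def
proof (rule normal_generateI)
  show "(\<Union>g\<in>carrier G. (\<lambda>s. g \<otimes> s \<otimes> inv g) ` S) \<subseteq> carrier G"
    using assms by auto
next
  fix h g
  assume "h \<in> (\<Union>g\<in>carrier G. (\<lambda>s. g \<otimes> s \<otimes> inv g) ` S)" and g: "g \<in> carrier G"
  then obtain a s where a: "a \<in> carrier G" "s \<in> S" "h = a \<otimes> s \<otimes> inv a"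
    by auto
  have "g \<otimes> h \<otimes> inv g = (g \<otimes> a) \<otimes> s \<otimes> inv (g \<otimes> a)"
    using a g assms by (auto simp: m_assoc inv_mult_group)
  then show "g \<otimes> h \<otimes> inv g \<in> (\<Union>g\<in>carrier G. (\<lambda>s. g \<otimes> s \<otimes> inv g) ` S)"
    using a g by blast
qed

lemma (in group) conj_in_normal_closure:
  "s \<in> S \<Longrightarrow> g \<in> carrier G \<Longrightarrow> g \<otimes> s \<otimes> inv g \<in> normal_closure G S"
  unfolding normal_closure_def by (intro generate.incl) auto

text \<open>With \<open>h' = h\<close> this passes from commuting with an element to commuting with
  its powers; in general it carries conjugacy over to powers.\<close>

lemma (in group) intertwine_nat_pow:
  assumes "x \<in> carrier G" "h \<in> carrier G" "h' \<in> carrier G" "x \<otimes> h = h' \<otimes> x"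
  shows "x \<otimes> h [^] (m::nat) = h' [^] m \<otimes> x"
proof (induction m)
  case (Suc m)
  have "x \<otimes> h [^] Suc m = h' [^] m \<otimes> x \<otimes> h"
    using Suc assms by (simp add: m_assoc[symmetric])
  also have "\<dots> = h' [^] Suc m \<otimes> x"
    using assms by (simp add: m_assoc)
  finally show ?case .
qed (use assms in simp)

subsection \<open>Coset enumeration and the weighted Schreier graph\<close>

text \<open>As \<open>p j\<close> is to satisfy \<open>p j ^^ m = id\<close> on the vertices, its
  power \<open>m - 1\<close> serves as the inverse.\<close>

definition signed_step :: "nat \<Rightarrow> (nat \<Rightarrow> nat \<Rightarrow> nat) \<Rightarrow> nat \<times> bool \<Rightarrow> nat \<Rightarrow> nat" where
  "signed_step m p a i = (if snd a then p (fst a) i else (p (fst a) ^^ (m - 1)) i)"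

text \<open>The walk from vertex \<open>i\<close> along \<open>w\<close>, its first letter being applied first, defined only if all
  edges it uses have rank below \<open>r\<close>.\<close>

primrec trace :: "nat \<Rightarrow> (nat \<Rightarrow> nat \<Rightarrow> nat) \<Rightarrow> (nat \<Rightarrow> nat \<Rightarrow> nat) \<Rightarrow> nat \<Rightarrow> braid_word \<Rightarrow> nat \<Rightarrow> nat option"
  where
    "trace m p rk r [] i = Some i"
  | "trace m p rk r (a # w) i =
      (if rk (fst a) (if snd a then i else signed_step m p a i) < r
       then trace m p rk r w (signed_step m p a i) else None)"

text \<open>Words that act as \<open>\<sigma>\<^sub>j\<close> does, by one of the relations between \<open>\<sigma>\<^sub>j\<close> and \<open>\<sigma>\<^sub>b\<close> or, if
  \<open>b = j\<close>, because \<open>\<sigma>\<^sub>j\<^sup>m\<close> lies in \<open>N\<close>.\<close>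

definition letter_rewrites :: "nat \<Rightarrow> nat \<Rightarrow> nat \<Rightarrow> braid_word list" where
  "letter_rewrites m j b =
    (if b = j then [replicate (m - 1) (j, False)]
     else if b = j + 1 \<or> j = b + 1 then
       [[(b, True), (j, True), (b, True), (j, False), (b, False)],
        [(b, False), (j, False), (b, True), (j, True), (b, True)],
        [(b, False), (j, True), (b, True), (j, True), (b, False)]]
     else [[(b, True), (j, True), (b, False)], [(b, False), (j, True), (b, True)]])"

text \<open>The vertices \<open>0..<k\<close> stand for the orbit elements, \<open>0\<close> for the class of \<open>\<sigma>\<^sub>1\<^sup>m\<close>; \<open>\<sigma>\<^sub>j\<close> moves \<open>i\<close>
  to \<open>p j i\<close> along an edge of weight \<open>u j i\<close>, and the positive word \<open>g i\<close> leads from \<open>0\<close> to \<open>i\<close>. An edge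
  of rank \<open>0\<close> holds by definition of the vertices or by a relation fixing vertex \<open>0\<close>; any other edge
  is deduced from edges of smaller rank by one relation.\<close>

locale coset_certificate =
  fixes n m k :: nat and d :: int
    and p :: "nat \<Rightarrow> nat \<Rightarrow> nat" and u :: "nat \<Rightarrow> nat \<Rightarrow> int"
    and rk :: "nat \<Rightarrow> nat \<Rightarrow> nat" and g :: "nat \<Rightarrow> nat list"
  assumes n: "3 \<le> n" and m: "0 < m" and k: "0 < k" and d: "d \<noteq> 0"
    and p_lt_check: "list_all (\<lambda>j. list_all (\<lambda>i. p j i < k) [0..<k]) [1..<n]"
    and p_pow_check: "list_all (\<lambda>j. list_all (\<lambda>i. (p j ^^ m) i = i) [0..<k]) [1..<n]"
    and u_pow_check: "list_all (\<lambda>i. (\<Sum>l\<leftarrow>[0..<m]. u 1 ((p 1 ^^ l) i)) = (if i = 0 then d else 0)) [0..<k]"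
    and braid_check: "list_all (\<lambda>a. list_all (\<lambda>i.
      p a (p (a + 1) (p a i)) = p (a + 1) (p a (p (a + 1) i)) \<and>
      u a i + u (a + 1) (p a i) + u a (p (a + 1) (p a i)) =
      u (a + 1) i + u a (p (a + 1) i) + u (a + 1) (p a (p (a + 1) i))) [0..<k]) [1..<n - 1]"
    and comm_check: "list_all (\<lambda>a. list_all (\<lambda>b. list_all (\<lambda>i.
      p a (p b i) = p b (p a i) \<and> u a i + u b (p a i) = u b i + u a (p b i)) [0..<k]) [a + 2..<n]) [1..<n]"
    and g_0: "g 0 = []"
    and g_check: "list_all (\<lambda>i. list_all (\<lambda>j. 1 \<le> j \<and> j < n) (g i) \<and> foldr p (g i) 0 = i) [0..<k]"
    and edge_check: "list_all (\<lambda>j. list_all (\<lambda>i.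
      if rk j i = 0
      then g (p j i) = j # g i \<or> p j i = 0 \<and> (g i = [] \<and> j \<noteq> 2 \<or> j # g i = [2, 1, 1, 2])
      else list_ex (\<lambda>b. list_ex (\<lambda>w. trace m p rk (rk j i) w i = Some (p j i)) (letter_rewrites m j b)) [1..<n])
      [0..<k]) [1..<n]"
begin

lemmas p_lt = p_lt_check[unfolded list_all_iff]
  and p_pow = p_pow_check[unfolded list_all_iff]
  and u_pow = u_pow_check[unfolded list_all_iff]
  and braid = braid_check[unfolded list_all_iff]
  and comm = comm_check[unfolded list_all_iff]
  and g_path = g_check[unfolded list_all_iff]
  and edges = edge_check[unfolded list_all_iff]

lemma p_less: "1 \<le> j \<Longrightarrow> j < n \<Longrightarrow> i < k \<Longrightarrow> p j i < k"
  using p_lt by simp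

lemma p_inv: 
  assumes "1 \<le> j" "j < n" "i < k"
  shows "p j ((p j ^^ (m - 1)) i) = i" "(p j ^^ (m - 1)) (p j i) = i" "(p j ^^ (m - 1)) i < k"
proof -
  have pow: "(p j ^^ l) i < k" for l
    using assms by (induction l) (auto simp: p_less)
  have "(p j ^^ Suc (m - 1)) i = i"
    using p_pow assms m by simp
  then show "p j ((p j ^^ (m - 1)) i) = i" "(p j ^^ (m - 1)) (p j i) = i"
    by (simp, simp only: funpow_Suc_right o_def)
  show "(p j ^^ (m - 1)) i < k" by (rule pow)
qed

section \<open>The conjugation action of braid words on the first homology of
  \<open>N\<close>\<close>

abbreviation "B \<equiv> braid_group n"
abbreviation "z \<equiv> braid_gen n 1 [^]\<^bsub>B\<^esub> m"
abbreviation "N \<equiv> normal_closure B {z}"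
abbreviation "A \<equiv> H1_N n m"
abbreviation "\<pi> x \<equiv> derived B N #>\<^bsub>B\<^esub> x"
abbreviation "S w \<equiv> conj_set B (braid_class n w)"

lemma z_closed: "z \<in> carrier B"
  using n by (simp add: braid_gen_def)

lemma N_normal: "N \<lhd> B"
  using z_closed by (simp add: braid.normal_closure_normal)

lemma N_subset: "N \<subseteq> carrier B"
  using normal_imp_subgroup[OF N_normal] by (rule subgroup.subset)

lemma A_eq: "A = abelianization (subgroup_generated B N)"
  by (simp add: H1_N_def)

lemmas A_simps = braid.carrier_abelianization_normal_subgroup[OF N_normal, folded A_eq]

lemma comm_group_A: "comm_group A"
  unfolding A_eq by (rule braid.comm_group_abelianization_normal_subgroup[OF N_normal])

lemma S_closed: "w \<in> braid_words n \<Longrightarrow> C \<in> carrier A \<Longrightarrow> S w C \<in> carrier A"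
  using braid.conj_set_closed[OF N_normal, folded A_eq] by simp

lemma S_letter_closed: "1 \<le> j \<Longrightarrow> j < n \<Longrightarrow> C \<in> carrier A \<Longrightarrow> S [(j, b)] C \<in> carrier A"
  using S_closed[of "[(j, b)]"] by simp

lemma S_append:
  "v \<in> braid_words n \<Longrightarrow> w \<in> braid_words n \<Longrightarrow> C \<in> carrier A \<Longrightarrow> S (v @ w) C = S v (S w C)"
  using braid.conj_set_mult braid.abelianization_normal_subgroup_subset[OF N_normal, folded A_eq]
  by (simp add: braid_class_append)

lemma S_Cons:
  "1 \<le> fst a \<Longrightarrow> fst a < n \<Longrightarrow> w \<in> braid_words n \<Longrightarrow> C \<in> carrier A \<Longrightarrow> S (a # w) C = S [a] (S w C)"
  using S_append[of "[a]" w] by simp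

lemma S_trivial: "braid_class n w \<in> N \<Longrightarrow> C \<in> carrier A \<Longrightarrow> S w C = C"
  using braid.conj_set_trivial[OF N_normal, folded A_eq] .

lemma S_coset:
  "w \<in> braid_words n \<Longrightarrow> x \<in> carrier B \<Longrightarrow>
    S w (\<pi> x) = \<pi> (braid_class n w \<otimes>\<^bsub>B\<^esub> x \<otimes>\<^bsub>B\<^esub> inv\<^bsub>B\<^esub> braid_class n w)"
  using braid.conj_set_r_coset[OF braid.derived_is_normal[OF N_normal]] by simp

lemma S_cong: "braid_eq n v w \<Longrightarrow> S v = S w"
  using braid_class_eq_iff braid_eq_words by metis

lemma S_Nil: "C \<in> carrier A \<Longrightarrow> S [] C = C"
  using S_trivial[of "[]" C] subgroup.one_closed[OF normal_imp_subgroup[OF N_normal]]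
  by (simp add: one_braid_group)

lemma S_cancel:
  assumes "1 \<le> j" "j < n" "C \<in> carrier A"
  shows "S [(j, b)] (S [(j, \<not> b)] C) = C"
proof -
  have "braid_eq n [(j, b), (j, \<not> b)] []"
    using br_cancel[of "[]" n "[]" j b] assms by simp
  then have "S [(j, b), (j, \<not> b)] C = C"
    using S_cong S_Nil assms by simp
  then show ?thesis
    using assms S_Cons[of "(j, b)" "[(j, \<not> b)]"] by simp
qed

lemma S_cancel':
  assumes "1 \<le> j" "j < n" "C \<in> carrier A"
  shows "S [(j, True)] (S [(j, False)] C) = C" "S [(j, False)] (S [(j, True)] C) = C"
  using S_cancel[OF assms, of True] S_cancel[OF assms, of False] by auto

lemma S_braid:
  assumes "1 \<le> a" "a < n" "1 \<le> b" "b < n" "a + 1 = b \<or> b + 1 = a" "C \<in> carrier A"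
  shows "S [(a, True)] (S [(b, True)] (S [(a, True)] C)) = S [(b, True)] (S [(a, True)] (S [(b, True)] C))"
proof -
  have "braid_eq n [(a, True), (b, True), (a, True)] [(b, True), (a, True), (b, True)]"
    using br_braid[of "[]" n "[]" a b] assms by simp
  from fun_cong[OF S_cong[OF this], of C] show ?thesis
    using assms S_Cons[of "(a, True)" "[(b, True), (a, True)]"] S_Cons[of "(b, True)" "[(a, True), (b, True)]"]
      S_Cons[of "(a, True)" "[(b, True)]"] S_Cons[of "(b, True)" "[(a, True)]"] by simp
qed

lemma S_comm:
  assumes "1 \<le> a" "a < n" "1 \<le> b" "b < n" "a + 1 < b \<or> b + 1 < a" "C \<in> carrier A"
  shows "S [(a, True)] (S [(b, True)] C) = S [(b, True)] (S [(a, True)] C)"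
proof -
  have "braid_eq n [(a, True), (b, True)] [(b, True), (a, True)]"
    using br_comm[of "[]" n "[]" a b] assms by simp
  from fun_cong[OF S_cong[OF this], of C] show ?thesis
    using assms S_Cons[of "(a, True)" "[(b, True)]"] S_Cons[of "(b, True)" "[(a, True)]"] by simp
qed

text \<open>The braid relation says that sigma_j sigma_(j+1) conjugates sigma_j to sigma_(j+1), so
  all the powers are conjugate to \<open>z\<close>.\<close>

lemma power_in_N: "1 \<le> j \<Longrightarrow> j < n \<Longrightarrow> braid_gen n j [^]\<^bsub>B\<^esub> m \<in> N"
proof (induction j rule: nat_induct_at_least)
  case base
  have "\<one>\<^bsub>B\<^esub> \<otimes>\<^bsub>B\<^esub> z \<otimes>\<^bsub>B\<^esub> inv\<^bsub>B\<^esub> \<one>\<^bsub>B\<^esub> \<in> N"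
    by (rule braid.conj_in_normal_closure) auto
  then show ?case using z_closed by simp
next
  case (Suc j)
  let ?x = "braid_class n [(j, True), (Suc j, True)]"
  have w: "[(j, True), (Suc j, True)] \<in> braid_words n" "[(j, True)] \<in> braid_words n" "[(Suc j, True)] \<in> braid_words n"
    using Suc by auto
  have gens: "braid_gen n j \<in> carrier B" "braid_gen n (Suc j) \<in> carrier B" "?x \<in> carrier B"
    using w by (auto simp: braid_gen_def)
  have "braid_eq n [(j, True), (Suc j, True), (j, True)] [(Suc j, True), (j, True), (Suc j, True)]"
    using br_braid[of "[]" n "[]" j "Suc j"] Suc by simp
  then have "?x \<otimes>\<^bsub>B\<^esub> braid_gen n j = braid_gen n (Suc j) \<otimes>\<^bsub>B\<^esub> ?x"
    using w braid_class_eq_iff braid_eq_words by (simp add: braid_gen_def flip: braid_class_append)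
  then have "?x \<otimes>\<^bsub>B\<^esub> braid_gen n j [^]\<^bsub>B\<^esub> m = braid_gen n (Suc j) [^]\<^bsub>B\<^esub> m \<otimes>\<^bsub>B\<^esub> ?x"
    using gens by (intro braid.intertwine_nat_pow)
  then have "braid_gen n (Suc j) [^]\<^bsub>B\<^esub> m = ?x \<otimes>\<^bsub>B\<^esub> braid_gen n j [^]\<^bsub>B\<^esub> m \<otimes>\<^bsub>B\<^esub> inv\<^bsub>B\<^esub> ?x"
    using gens by (simp add: braid.inv_solve_right)
  then show ?case
    using normal.inv_op_closed2[OF N_normal gens(3)] Suc by simp
qed

lemma S_pow:
  assumes "1 \<le> j" "j < n" "C \<in> carrier A"
  shows "(S [(j, True)] ^^ m) C = C"
proof -
  have "(S [(j, True)] ^^ l) C = S (replicate l (j, True)) C \<and> (S [(j, True)] ^^ l) C \<in> carrier A" for l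
  proof (induction l)
    case 0
    then show ?case using assms by (simp add: S_Nil)
  next
    case (Suc l)
    have "replicate l (j, True) \<in> braid_words n"
      using assms by (auto simp: braid_words_def)
    with Suc show ?case
      using assms S_Cons[of "(j, True)" "replicate l (j, True)"] S_letter_closed[of j _ True] by auto
  qed
  then show ?thesis
    using S_trivial power_in_N assms by (simp add: braid_gen_pow)
qed

lemma S_pow_inverse:
  assumes "1 \<le> j" "j < n" "C \<in> carrier A"
  shows "(S [(j, False)] ^^ (m - 1)) C = S [(j, True)] C"
proof -
  have pos: "(S [(j, True)] ^^ l) C \<in> carrier A" for l
    using assms S_closed[of "[(j, True)]"] by (induction l) auto
  \<comment> \<open>The surplus \<open>i\<close> is kept general for the induction;
    \<open>l = m - 1\<close> and \<open>i = 1\<close> then give exponent \<open>m\<close>, where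
    \<open>S_pow\<close> applies.\<close>
  have "(S [(j, False)] ^^ l) ((S [(j, True)] ^^ (l + i)) C) = (S [(j, True)] ^^ i) C" for l i
  proof (induction l)
    case (Suc l)
    have "(S [(j, False)] ^^ Suc l) ((S [(j, True)] ^^ (Suc l + i)) C) =
      (S [(j, False)] ^^ l) (S [(j, False)] (S [(j, True)] ((S [(j, True)] ^^ (l + i)) C)))"
      by (subst funpow_Suc_right) simp
    then show ?case
      using Suc S_cancel[OF assms(1,2) pos, of False] by simp
  qed simp
  from this[of "m - 1" 1] show ?thesis
    using S_pow[OF assms] m by simp
qed

text \<open>\<open>fold\<close> applies the first letter first, as \<open>trace\<close> does. Read
  in this order, each word is one of the relations jbj = bjb, jb = bj and j^m = 1, solved for
  j.\<close>

lemma letter_rewrites_sound: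
  assumes "1 \<le> j" "j < n" "1 \<le> b" "b < n" "C \<in> carrier A" "w \<in> set (letter_rewrites m j b)"
  shows "fold (\<lambda>a. S [a]) w C = S [(j, True)] C"
proof (cases "b = j")
  case True
  then have "w = replicate (m - 1) (j, False)"
    using assms by (simp add: letter_rewrites_def)
  moreover have "fold (\<lambda>a. S [a]) (replicate l (j, False)) = S [(j, False)] ^^ l" for l
    by (induction l) (simp_all add: funpow_Suc_right del: funpow.simps)
  ultimately show ?thesis
    using S_pow_inverse assms by simp
next
  case False
  note cl = S_letter_closed and cancel = S_cancel'
  show ?thesis
  proof (cases "b = j + 1 \<or> j = b + 1")
    case True
    have br: "S [(j, True)] (S [(b, True)] (S [(j, True)] C')) = S [(b, True)] (S [(j, True)] (S [(b, True)] C'))"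
      if "C' \<in> carrier A" for C'
      using S_braid[of j b C'] assms True that by auto
    from assms False True consider
        "w = [(b, True), (j, True), (b, True), (j, False), (b, False)]"
      | "w = [(b, False), (j, False), (b, True), (j, True), (b, True)]"
      | "w = [(b, False), (j, True), (b, True), (j, True), (b, False)]"
      by (auto simp: letter_rewrites_def)
    then show ?thesis
    proof cases
      case 1
      then show ?thesis using assms cl cancel by (simp flip: br)
    next
      case 2
      then show ?thesis using assms cl cancel by (simp flip: br)
    next
      case 3
      then show ?thesis using assms cl cancel by (simp add: br)
    qed
  next
    case nadj: False
    have far: "j + 1 < b \<or> b + 1 < j" using False nadj by linarith
    have co: "S [(j, True)] (S [(b, True)] C') = S [(b, True)] (S [(j, True)] C')"
      if "C' \<in> carrier A" for C'
      using S_comm[of j b C'] assms far that by simp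
    from assms False nadj consider
        "w = [(b, True), (j, True), (b, False)]" | "w = [(b, False), (j, True), (b, True)]"
      by (auto simp: letter_rewrites_def)
    then show ?thesis
      using assms cl cancel co by cases (simp, simp flip: co)
  qed
qed

section \<open>The orbit of the class of \<open>z\<close>\<close>

text \<open>Under \<open>S\<close> the last letter of a word acts first, in agreement with
  \<open>foldr p (g i) 0 = i\<close>.\<close>

definition y :: "nat \<Rightarrow> braid_word set set" where
  "y i = S (map (\<lambda>j. (j, True)) (g i)) (\<pi> z)"

lemma z_in_N: "z \<in> N"
  using power_in_N[of 1] n by simp

lemma pi_z_closed: "\<pi> z \<in> carrier A"
  using z_in_N by (auto simp: A_simps)

lemma g_words: "i < k \<Longrightarrow> map (\<lambda>j. (j, True)) (g i) \<in> braid_words n"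
  using g_path by (force simp: braid_words_def)

lemma y_closed: "i < k \<Longrightarrow> y i \<in> carrier A"
  unfolding y_def by (intro S_closed g_words pi_z_closed)

text \<open>An element that commutes with sigma_1 commutes with \<open>z\<close>, so conjugation by
  it fixes the class of \<open>z\<close>.\<close>

lemma S_pi_z:
  assumes "w \<in> braid_words n" "braid_eq n (w @ [(1, True)]) ([(1, True)] @ w)"
  shows "S w (\<pi> z) = \<pi> z"
proof -
  have one: "[(1, True)] \<in> braid_words n" using n by simp
  have "braid_class n w \<otimes>\<^bsub>B\<^esub> braid_gen n 1 = braid_gen n 1 \<otimes>\<^bsub>B\<^esub> braid_class n w"
    using assms one braid_eq_words[OF assms(2)]
    by (simp add: braid_gen_def braid_class_eq_iff flip: braid_class_append)
  then have "braid_class n w \<otimes>\<^bsub>B\<^esub> z = z \<otimes>\<^bsub>B\<^esub> braid_class n w"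
    using assms one by (intro braid.intertwine_nat_pow) (auto simp: braid_gen_def)
  then have "braid_class n w \<otimes>\<^bsub>B\<^esub> z \<otimes>\<^bsub>B\<^esub> inv\<^bsub>B\<^esub> braid_class n w = z"
    using assms z_closed by (simp add: braid.m_assoc)
  then show ?thesis
    using assms S_coset z_closed by simp
qed

lemma stabilizer_comm:
  assumes "1 \<le> j" "j < n" "j \<noteq> 2"
  shows "S [(j, True)] (\<pi> z) = \<pi> z"
proof (rule S_pi_z)
  show "braid_eq n ([(j, True)] @ [(1, True)]) ([(1, True)] @ [(j, True)])"
  proof (cases "j = 1")
    case True
    then show ?thesis using assms by (auto intro!: br_refl)
  next
    case False
    then show ?thesis using br_comm[of "[]" n "[]" j 1] assms by simp
  qed
qed (use assms in auto)

text \<open>Two braid moves carry a final sigma_1 through the word: 21121 = 21212 = 12112.\<close>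

lemma stabilizer_2112:
  "S [(2, True), (1, True), (1, True), (2, True)] (\<pi> z) = \<pi> z"
proof (rule S_pi_z)
  let ?a = "(1, True)" and ?b = "(2, True)"
  have "braid_eq n ([?b, ?a] @ [?a, ?b, ?a] @ []) ([?b, ?a] @ [?b, ?a, ?b] @ [])"
    by (rule br_braid) (use n in auto)
  moreover have "braid_eq n ([] @ [?b, ?a, ?b] @ [?a, ?b]) ([] @ [?a, ?b, ?a] @ [?a, ?b])"
    by (rule br_braid) (use n in auto)
  ultimately show "braid_eq n ([?b, ?a, ?a, ?b] @ [?a]) ([?a] @ [?b, ?a, ?a, ?b])"
    using br_trans by fastforce
qed (use n in auto)

text \<open>One stage of the coset enumeration: if all edges of rank below \<open>r\<close> are
  justified, so is every walk along them.\<close>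

lemma trace_sound:
  assumes below: "\<And>j i. 1 \<le> j \<Longrightarrow> j < n \<Longrightarrow> i < k \<Longrightarrow> rk j i < r \<Longrightarrow> S [(j, True)] (y i) = y (p j i)"
    and "w \<in> braid_words n" "i < k" "trace m p rk r w i = Some t"
  shows "fold (\<lambda>a. S [a]) w (y i) = y t"
  using assms(2-)
proof (induction w arbitrary: i)
  case (Cons a w)
  obtain j b where a: "a = (j, b)" by fastforce
  have j: "1 \<le> j" "j < n" and w: "w \<in> braid_words n" using Cons.prems a by auto
  let ?s = "signed_step m p a i"
  have s: "?s < k"
    using p_inv[OF j] p_less[OF j] Cons.prems a by (simp add: signed_step_def)
  have rk: "rk j (if b then i else ?s) < r" and tr: "trace m p rk r w ?s = Some t"
    using Cons.prems a by (auto split: if_splits)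
  have "S [a] (y i) = y ?s"
  proof (cases b)
    case True
    then show ?thesis using below[OF j Cons.prems(2)] rk a by (simp add: signed_step_def)
  next
    case False
    \<comment> \<open>An inverse letter runs backwards along the edge from \<open>?s\<close> to
      \<open>i\<close>, whose rank is therefore read at \<open>?s\<close>.\<close>
    then have "S [(j, True)] (y ?s) = y i"
      using below[OF j s] rk a p_inv[OF j Cons.prems(2)] by (simp add: signed_step_def)
    then show ?thesis
      using S_cancel[OF j y_closed[OF s], of False] a False by simp
  qed
  then show ?case
    using Cons.IH[OF w s tr] by simp
qed simp

text \<open>Induction on the rank of the edge: at positive rank, sigma_j is replaced by an
  equivalent word whose walk from \<open>i\<close> uses only edges of smaller rank.\<close>

lemma S_y: 
  assumes "1 \<le> j" "j < n" "i < k"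
  shows "S [(j, True)] (y i) = y (p j i)"
  using assms
proof (induction "rk j i" arbitrary: j i rule: less_induct)
  case less
  have S1: "S [(j, True)] (y i) = S ((j, True) # map (\<lambda>j. (j, True)) (g i)) (\<pi> z)"
    unfolding y_def using less.prems S_Cons[of "(j, True)"] g_words pi_z_closed by simp
  show ?case
  proof (cases "rk j i = 0")
    case True
    \<comment> \<open>Either \<open>g (p j i)\<close> extends \<open>g i\<close> by one letter, or
      sigma_j with j other than 2 fixes vertex 0, or the edge closes the walk of the stabilizing
      word 2112.\<close>
    then consider "g (p j i) = j # g i" | "p j i = 0" "g i = []" "j \<noteq> 2" | "p j i = 0" "j # g i = [2, 1, 1, 2]"
      using edges[rule_format, of j i] less.prems by auto
    then show ?thesis
    proof cases
      case 1
      then show ?thesis by (simp add: S1) (simp add: y_def)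
    next
      case 2
      then show ?thesis
        using stabilizer_comm less.prems pi_z_closed by (simp add: S1) (simp add: y_def g_0 S_Nil)
    next
      case 3
      then have "S [(j, True)] (y i) = \<pi> z"
        using stabilizer_2112 unfolding S1 by simp
      then show ?thesis
        using 3 pi_z_closed by (simp add: y_def[of 0] g_0 S_Nil)
    qed
  next
    case False
    then obtain b w where b: "b \<in> {1..<n}" "w \<in> set (letter_rewrites m j b)" "trace m p rk (rk j i) w i = Some (p j i)"
      using edges[rule_format, of j i] less.prems by (auto simp: list_ex_iff)
    moreover have "w \<in> braid_words n"
      using b less.prems by (auto simp: letter_rewrites_def braid_words_def split: if_splits)
    ultimately have "fold (\<lambda>a. S [a]) w (y i) = y (p j i)"
      using less.hyps less.prems by (intro trace_sound[where r = "rk j i"]) auto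
    then show ?thesis
      using letter_rewrites_sound[of j b "y i" w] b less.prems y_closed by simp
  qed
qed

text \<open>By \<open>S_y\<close> the elements \<open>y i\<close> are permuted by each generator,
  hence also by its inverse.\<close>

lemma S_word_pi_z: "w \<in> braid_words n \<Longrightarrow> S w (\<pi> z) \<in> y ` {..<k}"
proof (induction w)
  case Nil
  have "S [] (\<pi> z) = y 0" by (simp add: y_def g_0)
  then show ?case using k by blast
next
  case (Cons a w)
  obtain j b where a: "a = (j, b)" by fastforce
  have j: "1 \<le> j" "j < n" and w: "w \<in> braid_words n" using Cons.prems a by auto
  then obtain i where i: "i < k" "S w (\<pi> z) = y i" using Cons by auto
  have eq: "S (a # w) (\<pi> z) = S [(j, b)] (y i)"
    using S_Cons[of a w] a j w pi_z_closed i by simp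
  show ?case
  proof (cases b)
    case True
    then show ?thesis using eq S_y[OF j i(1)] p_less[OF j i(1)] by auto
  next
    case False
    let ?i = "(p j ^^ (m - 1)) i"
    have "S [(j, True)] (y ?i) = y i"
      using S_y[OF j] p_inv[OF j i(1)] by simp
    then have "S [(j, False)] (y i) = y ?i"
      using S_cancel[OF j y_closed[OF p_inv(3)[OF j i(1)]], of False] by simp
    then show ?thesis using eq False p_inv[OF j i(1)] by auto
  qed
qed

text \<open>\<open>N\<close> is generated by the conjugates of \<open>z\<close>, and their classes
  form the orbit of the class of \<open>z\<close>.\<close>

lemma generate_y: "carrier A \<subseteq> generate A (y ` {..<k})"
proof -
  let ?K = "\<Union>g\<in>carrier B. (\<lambda>s. g \<otimes>\<^bsub>B\<^esub> s \<otimes>\<^bsub>B\<^esub> inv\<^bsub>B\<^esub> g) ` {z}"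
  note sub = normal_imp_subgroup[OF N_normal]
  interpret A: comm_group A by (rule comm_group_A)
  interpret N: group "B\<lparr>carrier := N\<rparr>"
    by (rule braid.subgroup_imp_group[OF sub])
  interpret pi: group_hom "B\<lparr>carrier := N\<rparr>" A \<pi>
    by unfold_locales (rule braid.r_coset_hom_abelianization[OF N_normal, folded A_eq])
  have K: "?K \<subseteq> N"
    using braid.conj_in_normal_closure by blast
  have "carrier A = \<pi> ` generate (B\<lparr>carrier := N\<rparr>) ?K"
    using A_simps braid.generate_consistent[OF K sub] by (simp add: normal_closure_def)
  also have "\<dots> = generate A (\<pi> ` ?K)"
    using pi.generate_img[of ?K] K by simp
  also have "\<pi> ` ?K \<subseteq> y ` {..<k}"
    using S_word_pi_z S_coset z_closed by (fastforce simp: carrier_braid_group)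
  then have "generate A (\<pi> ` ?K) \<subseteq> generate A (y ` {..<k})"
    by (rule A.mono_generate)
  finally show ?thesis .
qed

section \<open>The weighted action on pairs of a vertex and an integer\<close>

text \<open>The identity off the vertex set makes \<open>move j\<close> a bijection of the whole
  type, as \<open>word_action_cong\<close> requires.\<close>

definition move :: "nat \<Rightarrow> nat \<times> int \<Rightarrow> nat \<times> int" where
  "move j = (\<lambda>(i, s). if i < k then (p j i, s + u j i) else (i, s))"

lemma bij_move:
  assumes "1 \<le> j" "j < n"
  shows "bij (move j)"
proof (rule o_bij)
  let ?q = "p j ^^ (m - 1)"
  \<comment> \<open>The weight to undo belongs to the edge that starts at the preimage
    \<open>?q i\<close>.\<close>
  let ?back = "\<lambda>(i, s). if i < k then (?q i, s - u j (?q i)) else (i, s)"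
  show "?back \<circ> move j = id"
    using p_inv[OF assms] p_less[OF assms] by (auto simp: move_def fun_eq_iff)
  show "move j \<circ> ?back = id"
    using p_inv[OF assms] by (auto simp: move_def fun_eq_iff)
qed

text \<open>In the first component the relations are those of the permutations; in the second they
  equate the weights summed along both sides. \<open>braid_check\<close> and
  \<open>comm_check\<close> state both.\<close>

lemma move_cong:
  assumes "braid_eq n v w"
  shows "word_action move v x = word_action move w x"
proof (rule word_action_cong[OF assms])
  show "bij (move j)" if "1 \<le> j" "j \<le> n - 1" for j
    using bij_move that by auto
  show "move a (move b x) = move b (move a x)" if "1 \<le> a" "a + 1 < b" "b \<le> n - 1" for a b x
    using comm[rule_format, of a b "fst x"] that p_less
    by (cases x) (simp add: move_def add.assoc)
  show "move a (move (a + 1) (move a x)) = move (a + 1) (move a (move (a + 1) x))"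
    if "1 \<le> a" "a + 1 \<le> n - 1" for a x
    using braid[rule_format, of a "fst x"] that p_less
    by (cases x) (simp add: move_def add.assoc)
qed

definition T :: "braid_word set \<Rightarrow> nat \<times> int \<Rightarrow> nat \<times> int" where
  "T x = word_action move (SOME w. w \<in> x)"

lemma T_class: "w \<in> braid_words n \<Longrightarrow> T (braid_class n w) = word_action move w"
  using move_cong[OF braid_eq_some_in_class] by (auto simp: T_def fun_eq_iff)

lemma T_mult:
  "x \<in> carrier B \<Longrightarrow> x' \<in> carrier B \<Longrightarrow> T (x \<otimes>\<^bsub>B\<^esub> x') v = T x (T x' v)"
  by (auto simp: carrier_braid_group T_class word_action_append simp flip: braid_class_append)

lemma T_one: "T \<one>\<^bsub>B\<^esub> v = v"
  by (simp add: one_braid_group T_class)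

lemma T_inv: "x \<in> carrier B \<Longrightarrow> T x (T (inv\<^bsub>B\<^esub> x) v) = v"
  by (simp flip: T_mult add: T_one)

text \<open>Each \<open>move j\<close> adds an amount independent of \<open>s\<close>, so it
  commutes with translation, and so does its inverse.\<close>

lemma T_shift:
  assumes "x \<in> carrier B"
  shows "T x (i, s + c) = map_prod id (\<lambda>t. t + c) (T x (i, s))"
proof -
  obtain w where w: "x = braid_class n w" "w \<in> braid_words n"
    using assms by (auto simp: carrier_braid_group)
  define shift where "shift v = map_prod id (\<lambda>t. t + c) v" for v :: "nat \<times> int"
  have "word_action move w (shift v) = shift (word_action move w v)" for v
    using w(2)
  proof (induction w)
    case (Cons a w)
    obtain j b where a: "a = (j, b)" by fastforce
    have bij: "bij (move j)" using bij_move Cons.prems a by simp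
    have pos: "move j (shift v) = shift (move j v)" for v
      by (cases v) (simp add: move_def shift_def)
    have neg: "inv_into UNIV (move j) (shift v) =
        shift (inv_into UNIV (move j) v)" for v
      by (rule inv_f_eq[OF bij_is_inj[OF bij]]) (simp add: pos surj_f_inv_f[OF bij_is_surj[OF bij]])
    show ?case using Cons a by (simp add: pos neg)
  qed simp
  from this[of "(i, s)"] show ?thesis
    using w by (simp add: T_class shift_def)
qed

text \<open>For \<open>x\<close> in \<open>N\<close> this is the amount by which \<open>x\<close>
  translates the fibre over \<open>i\<close>, by \<open>T_N\<close> below.\<close>

definition \<tau> :: "braid_word set \<Rightarrow> nat \<Rightarrow> int" where
  "\<tau> x i = snd (T x (i, 0))"

text \<open>The power sigma_1^m walks \<open>m\<close> steps along the closed
  \<open>p 1\<close>-orbit of \<open>i\<close>; \<open>u_pow_check\<close> gives the total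
  weight.\<close>

lemma T_z: "T z (i, s) = (i, s + (if i = 0 then d else 0))"
proof -
  have words: "replicate l (1, True) \<in> braid_words n" for l
    using n by (auto simp: braid_words_def)
  have "word_action move (replicate l (1, True)) (i, s) =
      (if i < k then ((p 1 ^^ l) i, s + (\<Sum>l\<leftarrow>[0..<l]. u 1 ((p 1 ^^ l) i))) else (i, s)) \<and>
      (i < k \<longrightarrow> (p 1 ^^ l) i < k)" for l
    using n p_less[of 1] by (induction l) (auto simp: move_def)
  \<comment> \<open>If \<open>i\<close> is not a vertex, \<open>z\<close> fixes the pair, and
    \<open>i\<close> is nonzero because \<open>0 < k\<close>.\<close>
  from this[of m] show ?thesis
    using words n p_pow u_pow k by (auto simp: braid_gen_pow T_class)
qed

text \<open>The elements that translate every fibre separately form a subgroup \<open>H\<close>; it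
  suffices that all conjugates of \<open>z\<close> lie in \<open>H\<close>.\<close>

lemma T_N:
  assumes "x \<in> N"
  shows "T x (i, s) = (i, s + \<tau> x i)"
proof -
  define H where "H = {x \<in> carrier B. \<exists>t. \<forall>i s. T x (i, s) = (i, s + t i)}"
  have "subgroup H B"
  proof (rule braid.subgroupI)
    show "H \<subseteq> carrier B" by (auto simp: H_def)
    have "\<one>\<^bsub>B\<^esub> \<in> H"
      by (auto simp: H_def T_one intro: exI[of _ "\<lambda>_. 0"])
    then show "H \<noteq> {}" by blast
  next
    fix x assume "x \<in> H"
    then obtain t where x: "x \<in> carrier B" "\<And>i s. T x (i, s) = (i, s + t i)"
      by (auto simp: H_def)
    have "T (inv\<^bsub>B\<^esub> x) (i, s) = (i, s + - t i)" for i s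
      using T_inv[OF x(1), of "(i, s)"] x(2) by (cases "T (inv\<^bsub>B\<^esub> x) (i, s)") auto
    then show "inv\<^bsub>B\<^esub> x \<in> H"
      using x(1) by (auto simp: H_def)
  next
    fix x x' assume "x \<in> H" "x' \<in> H"
    then obtain t t' where x: "x \<in> carrier B" "\<And>i s. T x (i, s) = (i, s + t i)"
      and x': "x' \<in> carrier B" "\<And>i s. T x' (i, s) = (i, s + t' i)"
      by (auto simp: H_def)
    have "T (x \<otimes>\<^bsub>B\<^esub> x') (i, s) = (i, s + (t' i + t i))" for i s
      using x x' by (simp add: T_mult)
    then show "x \<otimes>\<^bsub>B\<^esub> x' \<in> H"
      using x(1) x'(1) by (auto simp: H_def intro!: exI[of _ "\<lambda>i. t' i + t i"])
  qed
  moreover have "(\<Union>h\<in>carrier B. (\<lambda>x. h \<otimes>\<^bsub>B\<^esub> x \<otimes>\<^bsub>B\<^esub> inv\<^bsub>B\<^esub> h) ` {z}) \<subseteq> H"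
  proof -
    have "h \<otimes>\<^bsub>B\<^esub> z \<otimes>\<^bsub>B\<^esub> inv\<^bsub>B\<^esub> h \<in> H" if h: "h \<in> carrier B" for h
    proof -
      let ?x = "h \<otimes>\<^bsub>B\<^esub> z \<otimes>\<^bsub>B\<^esub> inv\<^bsub>B\<^esub> h"
      \<comment> \<open>The inverse of \<open>h\<close> takes the fibre over \<open>i\<close> to
        another fibre, \<open>z\<close> translates that one by \<open>d\<close> exactly if it lies
        over 0, and \<open>h\<close> takes it back.\<close>
      have "T ?x (i, s) = (i, s + (if fst (T (inv\<^bsub>B\<^esub> h) (i, 0)) = 0 then d else 0))" for i s
      proof -
        obtain i' s' where i': "T (inv\<^bsub>B\<^esub> h) (i, 0) = (i', s')" by fastforce
        have "T ?x (i, s) = T h (T z (T (inv\<^bsub>B\<^esub> h) (i, 0 + s)))"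
          using h z_closed by (simp add: T_mult)
        also have "T (inv\<^bsub>B\<^esub> h) (i, 0 + s) = (i', s' + s)"
          using h i' by (subst T_shift) auto
        also have "T z (i', s' + s) = (i', s' + (s + (if i' = 0 then d else 0)))"
          by (simp add: T_z del: One_nat_def)
        also have "T h \<dots> = (i, s + (if i' = 0 then d else 0))"
          using T_inv[OF h, of "(i, 0)"] h i' by (subst T_shift) auto
        finally show ?thesis using i' by simp
      qed
      moreover have "?x \<in> carrier B" using h z_closed by simp
      ultimately show ?thesis
        unfolding H_def
        by (intro CollectI conjI exI[of _ "\<lambda>i. if fst (T (inv\<^bsub>B\<^esub> h) (i, 0)) = 0 then d else 0"]) auto
    qed
    then show ?thesis by blast
  qed
  ultimately have "N \<subseteq> H"
    unfolding normal_closure_def by (intro braid.generate_subgroup_incl)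
  then obtain t where "\<And>i s. T x (i, s) = (i, s + t i)"
    using assms by (auto simp: H_def)
  then show ?thesis by (simp add: \<tau>_def)
qed

lemma \<tau>_hom: "(\<lambda>x. \<tau> x i) \<in> hom (B\<lparr>carrier := N\<rparr>) integer_group"
proof (rule homI)
  fix x x' assume "x \<in> carrier (B\<lparr>carrier := N\<rparr>)" "x' \<in> carrier (B\<lparr>carrier := N\<rparr>)"
  then have "x \<in> N" "x' \<in> N" "x \<in> carrier B" "x' \<in> carrier B"
    using N_subset by auto
  then show "\<tau> (x \<otimes>\<^bsub>B\<lparr>carrier := N\<rparr>\<^esub> x') i = \<tau> x i \<otimes>\<^bsub>integer_group\<^esub> \<tau> x' i"
    by (simp add: \<tau>_def[of "x \<otimes>\<^bsub>B\<^esub> x'"] T_mult T_N)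
qed auto

abbreviation conjz :: "braid_word \<Rightarrow> braid_word set" where
  "conjz w \<equiv> braid_class n w \<otimes>\<^bsub>B\<^esub> z \<otimes>\<^bsub>B\<^esub> inv\<^bsub>B\<^esub> braid_class n w"

text \<open>Conjugating by sigma_j moves the translated fibre along \<open>p j\<close>. The bound on
  \<open>foldr p v 0\<close> is proved along with this, so that \<open>p j\<close> can be inverted
  there.\<close>

lemma \<tau>_conjz:
  assumes "\<forall>j\<in>set v. 1 \<le> j \<and> j < n" "i < k"
  shows "\<tau> (conjz (map (\<lambda>j. (j, True)) v)) i = (if i = foldr p v 0 then d else 0) \<and> foldr p v 0 < k"
  using assms
proof (induction v arbitrary: i)
  case Nil
  have "conjz [] = z" using z_closed by (simp flip: one_braid_group)
  then show ?case using k by (simp add: \<tau>_def T_z del: One_nat_def)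
next
  case (Cons j v)
  have j: "1 \<le> j" "j < n" using Cons.prems by auto
  let ?s = "braid_class n [(j, True)]" and ?w = "map (\<lambda>j. (j, True)) v"
  let ?x = "conjz ?w" and ?x' = "conjz (map (\<lambda>j. (j, True)) (j # v))"
  have w: "?w \<in> braid_words n" using Cons.prems by (auto simp: braid_words_def)
  have s: "?s \<in> carrier B" using j by simp
  have N: "?x \<in> N" "?x' \<in> N"
    using braid.conj_in_normal_closure w j by auto
  then have x: "?x \<in> carrier B" using N_subset by auto
  have "braid_class n ((j, True) # ?w) = ?s \<otimes>\<^bsub>B\<^esub> braid_class n ?w"
    using w j by (simp flip: braid_class_append)
  then have "?x' = ?s \<otimes>\<^bsub>B\<^esub> ?x \<otimes>\<^bsub>B\<^esub> inv\<^bsub>B\<^esub> ?s"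
    using w s z_closed by (simp add: braid.m_assoc braid.inv_mult_group)
  then have x's: "?x' \<otimes>\<^bsub>B\<^esub> ?s = ?s \<otimes>\<^bsub>B\<^esub> ?x"
    using s x by (simp add: braid.m_assoc)
  \<comment> \<open>Both sides of \<open>x's\<close> are applied on the fibre over the preimage of
    \<open>i\<close>; the weight of the edge cancels.\<close>
  let ?i = "(p j ^^ (m - 1)) i"
  note i = p_inv[OF j Cons.prems(2)]
  have "T ?x' (T ?s (?i, 0)) = T ?s (T ?x (?i, 0))"
    using T_mult[of ?x' ?s] T_mult[of ?s ?x] N_subset N s x x's by auto
  moreover have "T ?s (?i, c) = (i, c + u j ?i)" for c
    using i j by (simp add: T_class move_def)
  ultimately have "\<tau> ?x' i = \<tau> ?x ?i"
    using T_N[OF N(2), of i "u j ?i"] T_N[OF N(1), of ?i 0] by (simp del: One_nat_def)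
  moreover have IH: "\<tau> ?x ?i = (if ?i = foldr p v 0 then d else 0)" "foldr p v 0 < k"
    using Cons.IH[of ?i] Cons.prems i by auto
  moreover have "?i = foldr p v 0 \<longleftrightarrow> i = p j (foldr p v 0)"
    using i p_inv[OF j IH(2)] by auto
  ultimately show ?case
    using p_less[OF j IH(2)] by simp
qed

text \<open>The translation amounts factor through the abelianization and are dual, up to
  \<open>d\<close>, to the generators \<open>y\<close>.\<close>

theorem H1_N_free: "A \<cong> free_Abelian_group {..<k}"
proof -
  note sub = normal_imp_subgroup[OF N_normal]
  interpret A: comm_group A by (rule comm_group_A)
  interpret N: group "B\<lparr>carrier := N\<rparr>"
    by (rule braid.subgroup_imp_group[OF sub])
  have derived: "derived (B\<lparr>carrier := N\<rparr>) N = derived B N"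
    by (rule braid.derived_consistent[OF _ sub]) simp
  \<comment> \<open>Restricting the carrier to \<open>N\<close> and
    \<open>subgroup_generated\<close> lead to the same quotient by
    \<open>derived B N\<close>.\<close>
  have ab: "abelianization (B\<lparr>carrier := N\<rparr>) = A"
    using braid.abelianization_normal_subgroup[OF N_normal]
    by (simp add: H1_N_def abelianization_def derived del: One_nat_def)
  have "\<exists>f. f \<in> hom A integer_group \<and> (\<forall>x\<in>N. f (\<pi> x) = \<tau> x i)" for i
  proof -
    obtain f where f: "f \<in> hom (abelianization (B\<lparr>carrier := N\<rparr>)) integer_group"
      "\<And>x. x \<in> carrier (B\<lparr>carrier := N\<rparr>) \<Longrightarrow>
        f (derived (B\<lparr>carrier := N\<rparr>) (carrier (B\<lparr>carrier := N\<rparr>)) #>\<^bsub>B\<lparr>carrier := N\<rparr>\<^esub> x) = \<tau> x i"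
      using N.abelianization_universal[OF \<tau>_hom[of i] abelian_integer_group] by blast
    have "f (\<pi> x) = \<tau> x i" if "x \<in> N" for x
      using f(2)[of x] that by (simp add: derived r_coset_def del: One_nat_def)
    then show ?thesis
      using f(1) ab by auto
  qed
  then obtain \<phi> where \<phi>: "\<And>i. \<phi> i \<in> hom A integer_group" "\<And>i x. x \<in> N \<Longrightarrow> \<phi> i (\<pi> x) = \<tau> x i"
    by metis
  show ?thesis
  proof (rule A.isomorphic_free_Abelian_group_if_dual[OF y_closed generate_y \<phi>(1) _ d])
    fix i j assume ij: "i < k" "j < k"
    let ?w = "map (\<lambda>j. (j, True)) (g j)"
    have "conjz ?w \<in> N"
      using braid.conj_in_normal_closure g_words ij by simp
    moreover have "y j = \<pi> (conjz ?w)"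
      using S_coset z_closed g_words ij by (simp add: y_def)
    ultimately show "\<phi> i (y j) = (if i = j then d else 0)"
      using \<phi>(2) \<tau>_conjz[of "g j" i] g_path ij by simp
  qed
qed

end

subsection \<open>The five tables\<close>

text \<open>Turns the definition of a table into one rewrite rule per entry, so that looking up an entry
  does not unfold the list.\<close>

primrec entries :: "'a list \<Rightarrow> nat \<Rightarrow> 'a list \<Rightarrow> bool" where
  "entries L i [] = True"
| "entries L i (x # xs) = (L ! i = x \<and> entries L (Suc i) xs)"

lemma entries_drop: "entries L i (drop i L)"
proof (induction "drop i L" arbitrary: i)
  case (Cons x xs)
  from this(2) have "i < length L" by (cases "i < length L") auto
  then have "drop i L = L ! i # drop (Suc i) L" by (simp add: Cons_nth_drop_Suc)
  with Cons(1)[of "Suc i"] Cons(2) show ?case by simp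
qed simp

lemma entries_0: "L = xs \<Longrightarrow> entries L 0 xs"
  using entries_drop[of L 0] by simp

text \<open>Row \<open>j\<close> lists, for each vertex, the image under \<open>\<sigma>\<^sub>j\<close>, the weight and the rank of that edge. The
  images are the action on the mirrors of the complex reflection group \<open>B\<^sub>n/N\<close>; the weights solve
  the linear equations \<open>braid_check\<close>, \<open>comm_check\<close> and \<open>u_pow_check\<close>, normalised to vanish on a
  spanning tree.\<close>

definition target :: "(nat \<times> int \<times> nat) list list \<Rightarrow> nat \<Rightarrow> nat \<Rightarrow> nat" where
  "target R j i = fst (R ! (j - 1) ! i)"

definition weight :: "(nat \<times> int \<times> nat) list list \<Rightarrow> nat \<Rightarrow> nat \<Rightarrow> int" where
  "weight R j i = fst (snd (R ! (j - 1) ! i))"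

definition rank :: "(nat \<times> int \<times> nat) list list \<Rightarrow> nat \<Rightarrow> nat \<Rightarrow> nat" where
  "rank R j i = snd (snd (R ! (j - 1) ! i))"

text \<open>Lets the simplifier unfold iterates with a literal exponent.\<close>

lemma funpow_numeral: "(f ^^ numeral v) x = f ((f ^^ pred_numeral v) x)"
  by (simp add: numeral_eq_Suc)

lemma replicate_numeral: "replicate (numeral v) x = x # replicate (pred_numeral v) x"
  by (simp add: numeral_eq_Suc)

text \<open>Brings indices that are counted up by \<open>Suc\<close> into numeral form, so that the
  table rules match.\<close>

lemma Suc_Suc_0 [simp]: "Suc (Suc 0) = 2"
  by simp

lemmas certificate_simps = target_def weight_def rank_def signed_step_def letter_rewrites_def
  funpow_numeral replicate_numeral upt_rec

section \<open>Three strands, exponent 3: the Shephard-Todd group G_4, with 4 mirrors\<close>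

definition row_3_3_1 :: "(nat \<times> int \<times> nat) list" where
  "row_3_3_1 = [
    (0, 2, 0), (2, 0, 0), (3, 0, 0), (1, 0, 1)]"

definition row_3_3_2 :: "(nat \<times> int \<times> nat) list" where
  "row_3_3_2 = [
    (1, 0, 0), (3, 1, 1), (2, 2, 1), (0, -1, 0)]"

definition words_3_3 :: "nat list list" where
  "words_3_3 = [
    [], [2], [1, 2], [1, 1, 2]]"

lemmas table_3_3 =
  entries_0[OF row_3_3_1_def, simplified]
  entries_0[OF row_3_3_2_def, simplified]
  entries_0[OF words_3_3_def, simplified]

text \<open>The value of \<open>d\<close> is \<open>m\<close> times the weight of the loop of
  sigma_1 at vertex 0, here 3 * 2; likewise in the other cases.\<close>

lemma certificate_3_3:
  "coset_certificate 3 3 4 6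
    (target [row_3_3_1, row_3_3_2])
    (weight [row_3_3_1, row_3_3_2])
    (rank [row_3_3_1, row_3_3_2]) ((!) words_3_3)"
  by unfold_locales (simp_all add: table_3_3 certificate_simps)

section \<open>Three strands, exponent 4: the group G_8, with 6 mirrors\<close>

definition row_3_4_1 :: "(nat \<times> int \<times> nat) list" where
  "row_3_4_1 = [
    (0, 1, 0), (2, 0, 0), (3, 0, 0), (5, 0, 0), (4, 0, 2), (1, 0, 1)]"

definition row_3_4_2 :: "(nat \<times> int \<times> nat) list" where
  "row_3_4_2 = [
    (1, 0, 0), (4, 0, 0), (2, 1, 1), (0, -1, 0), (3, 1, 1), (5, 0, 2)]"

definition words_3_4 :: "nat list list" where
  "words_3_4 = [
    [], [2], [1, 2], [1, 1, 2], [2, 2], [1, 1, 1, 2]]"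

lemmas table_3_4 =
  entries_0[OF row_3_4_1_def, simplified]
  entries_0[OF row_3_4_2_def, simplified]
  entries_0[OF words_3_4_def, simplified]

lemma certificate_3_4:
  "coset_certificate 3 4 6 4
    (target [row_3_4_1, row_3_4_2])
    (weight [row_3_4_1, row_3_4_2])
    (rank [row_3_4_1, row_3_4_2]) ((!) words_3_4)"
  by unfold_locales (simp_all add: table_3_4 certificate_simps)

section \<open>Three strands, exponent 5: the group G_16, with 12 mirrors\<close>

definition row_3_5_1 :: "(nat \<times> int \<times> nat) list" where
  "row_3_5_1 = [
    (0, 2, 0), (2, 0, 0), (3, 0, 0), (6, 0, 0), (5, 0, 0), (7, 0, 0), (8, 0, 0), (9, 0, 0),
    (1, 0, 1), (10, 1, 4), (4, -1, 3), (11, 0, 5)]"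

definition row_3_5_2 :: "(nat \<times> int \<times> nat) list" where
  "row_3_5_2 = [
    (1, 0, 0), (4, 0, 0), (2, 2, 1), (0, -3, 0), (5, 1, 3), (3, 2, 2), (8, -1, 2), (6, 1, 3),
    (10, 0, 0), (9, 0, 5), (11, 0, 0), (7, 0, 4)]"

definition words_3_5 :: "nat list list" where
  "words_3_5 = [
    [], [2], [1, 2], [1, 1, 2], [2, 2], [1, 2, 2], [1, 1, 1, 2], [1, 1, 2, 2], [1, 1, 1, 1, 2],
    [1, 1, 1, 2, 2], [2, 1, 1, 1, 1, 2], [2, 2, 1, 1, 1, 1, 2]]"

lemmas table_3_5 =
  entries_0[OF row_3_5_1_def, simplified]
  entries_0[OF row_3_5_2_def, simplified]
  entries_0[OF words_3_5_def, simplified]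

lemma certificate_3_5:
  "coset_certificate 3 5 12 10
    (target [row_3_5_1, row_3_5_2])
    (weight [row_3_5_1, row_3_5_2])
    (rank [row_3_5_1, row_3_5_2]) ((!) words_3_5)"
  by unfold_locales (simp_all add: table_3_5 certificate_simps)

section \<open>Four strands, exponent 3: the group G_25, with 12 mirrors\<close>

definition row_4_3_1 :: "(nat \<times> int \<times> nat) list" where
  "row_4_3_1 = [
    (0, 2, 0), (2, 0, 0), (3, 0, 0), (1, 0, 1), (5, 0, 1), (6, 0, 1), (4, 0, 2), (9, 0, 2),
    (8, 0, 2), (10, 0, 2), (7, 0, 2), (11, 0, 3)]"

definition row_4_3_2 :: "(nat \<times> int \<times> nat) list" where
  "row_4_3_2 = [
    (1, 0, 0), (3, 1, 1), (2, 2, 1), (0, -1, 0), (4, 0, 1), (8, 0, 0), (7, -1, 2), (11, 0, 0),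
    (9, -1, 3), (5, 1, 3), (10, 0, 2), (6, 1, 3)]"

definition row_4_3_3 :: "(nat \<times> int \<times> nat) list" where
  "row_4_3_3 = [
    (0, 0, 0), (4, 0, 0), (5, 0, 0), (6, 0, 0), (7, 0, 0), (9, 0, 0), (10, 0, 0), (1, 0, 1),
    (8, 2, 2), (2, 0, 1), (3, 0, 1), (11, 0, 2)]"

definition words_4_3 :: "nat list list" where
  "words_4_3 = [
    [], [2], [1, 2], [1, 1, 2], [3, 2], [3, 1, 2], [3, 1, 1, 2], [3, 3, 2], [2, 3, 1, 2],
    [3, 3, 1, 2], [3, 3, 1, 1, 2], [2, 3, 3, 2]]"

lemmas table_4_3 =
  entries_0[OF row_4_3_1_def, simplified]
  entries_0[OF row_4_3_2_def, simplified]
  entries_0[OF row_4_3_3_def, simplified]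
  entries_0[OF words_4_3_def, simplified]

lemma certificate_4_3:
  "coset_certificate 4 3 12 6
    (target [row_4_3_1, row_4_3_2, row_4_3_3])
    (weight [row_4_3_1, row_4_3_2, row_4_3_3])
    (rank [row_4_3_1, row_4_3_2, row_4_3_3]) ((!) words_4_3)"
  by unfold_locales (simp_all add: table_4_3 certificate_simps)

section \<open>Five strands, exponent 3: the group G_32, with 40 mirrors\<close>

definition row_5_3_1 :: "(nat \<times> int \<times> nat) list" where
  "row_5_3_1 = [
    (0, 2, 0), (2, 0, 0), (3, 0, 0), (1, 0, 1), (5, 0, 1), (6, 0, 1), (4, 0, 2), (10, 0, 2),
    (11, 0, 2), (9, 0, 2), (12, 0, 2), (13, 0, 2), (7, 0, 2), (8, 0, 3), (14, 0, 3), (18, 0, 3),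
    (19, 0, 2), (17, 0, 3), (20, 0, 3), (21, 0, 2), (15, 0, 3), (16, 0, 3), (22, 0, 4), (27, 0, 3),
    (28, 0, 3), (25, 0, 4), (26, 0, 3), (29, 0, 3), (30, 0, 3), (23, 0, 3), (24, 0, 4), (31, 0, 5),
    (32, 0, 4), (37, 0, 0), (34, 0, 5), (35, 0, 5), (36, 0, 5), (39, 0, 0), (38, 0, 6), (33, 0, 1)]"

definition row_5_3_2 :: "(nat \<times> int \<times> nat) list" where
  "row_5_3_2 = [
    (1, 0, 0), (3, 1, 1), (2, 2, 1), (0, -1, 0), (4, 0, 1), (9, 0, 0), (7, -1, 2), (14, 0, 0),
    (8, 0, 2), (10, -1, 3), (5, 1, 3), (17, 0, 1), (12, 0, 2), (15, -1, 3), (6, 1, 3), (22, 0, 1),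
    (16, 0, 2), (18, -1, 4), (11, 1, 4), (26, 0, 2), (20, 0, 3), (23, -1, 3), (13, 1, 4),
    (32, 0, 2), (33, 0, 0), (25, 0, 4), (27, -1, 4), (19, 1, 4), (28, 0, 5), (29, 0, 3), (34, 0, 0),
    (24, 0, 3), (21, 1, 4), (31, 0, 4), (37, 0, 6), (35, 0, 4), (36, 0, 3), (30, 0, 6), (38, 0, 5),
    (39, 0, 6)]"

definition row_5_3_3 :: "(nat \<times> int \<times> nat) list" where
  "row_5_3_3 = [
    (0, 0, 0), (4, 0, 0), (5, 0, 0), (6, 0, 0), (7, 0, 0), (10, 0, 0), (12, 0, 0), (1, 0, 1),
    (8, 0, 2), (9, 2, 2), (2, 0, 1), (11, 0, 3), (3, 0, 1), (13, 0, 2), (14, 0, 2), (16, 0, 2),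
    (24, 0, 0), (25, 0, 0), (19, 0, 3), (28, 0, 0), (21, 0, 2), (30, 0, 0), (31, 0, 0), (23, 0, 2),
    (15, 0, 3), (26, -1, 5), (17, 1, 5), (27, 0, 3), (18, 0, 4), (29, 0, 2), (20, 0, 3), (35, 0, 0),
    (36, 0, 0), (33, 0, 3), (32, -1, 4), (22, 0, 1), (34, 1, 5), (37, 0, 4), (38, 0, 4), (39, 0, 4)]"

definition row_5_3_4 :: "(nat \<times> int \<times> nat) list" where
  "row_5_3_4 = [
    (0, 0, 0), (1, 0, 1), (2, 0, 2), (3, 0, 1), (8, 0, 0), (11, 0, 0), (13, 0, 0), (15, 0, 0),
    (16, 0, 0), (17, 0, 0), (18, 0, 0), (19, 0, 0), (20, 0, 0), (21, 0, 0), (22, 0, 0), (23, 0, 0),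
    (4, 0, 1), (26, 0, 0), (27, 0, 0), (5, 0, 1), (29, 0, 0), (6, 0, 1), (32, 0, 0), (7, 0, 1),
    (24, 0, 3), (25, 2, 3), (9, 0, 1), (10, 0, 1), (28, 0, 4), (12, 0, 1), (30, 0, 3), (31, 0, 3),
    (14, 0, 1), (33, 0, 4), (34, 0, 4), (38, 0, 0), (35, 0, 3), (37, 0, 5), (36, 0, 4), (39, 0, 5)]"

definition words_5_3 :: "nat list list" where
  "words_5_3 = [
    [], [2], [1, 2], [1, 1, 2], [3, 2], [3, 1, 2], [3, 1, 1, 2], [3, 3, 2], [4, 3, 2], [2, 3, 1, 2],
    [3, 3, 1, 2], [4, 3, 1, 2], [3, 3, 1, 1, 2], [4, 3, 1, 1, 2], [2, 3, 3, 2], [4, 3, 3, 2],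
    [4, 4, 3, 2], [4, 2, 3, 1, 2], [4, 3, 3, 1, 2], [4, 4, 3, 1, 2], [4, 3, 3, 1, 1, 2],
    [4, 4, 3, 1, 1, 2], [4, 2, 3, 3, 2], [4, 4, 3, 3, 2], [3, 4, 4, 3, 2], [3, 4, 2, 3, 1, 2],
    [4, 4, 2, 3, 1, 2], [4, 4, 3, 3, 1, 2], [3, 4, 4, 3, 1, 2], [4, 4, 3, 3, 1, 1, 2],
    [3, 4, 4, 3, 1, 1, 2], [3, 4, 2, 3, 3, 2], [4, 4, 2, 3, 3, 2], [2, 3, 4, 4, 3, 2],
    [2, 3, 4, 4, 3, 1, 1, 2], [3, 3, 4, 2, 3, 3, 2], [3, 4, 4, 2, 3, 3, 2], [1, 2, 3, 4, 4, 3, 2],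
    [4, 3, 3, 4, 2, 3, 3, 2], [1, 1, 2, 3, 4, 4, 3, 2]]"

lemmas table_5_3 =
  entries_0[OF row_5_3_1_def, simplified]
  entries_0[OF row_5_3_2_def, simplified]
  entries_0[OF row_5_3_3_def, simplified]
  entries_0[OF row_5_3_4_def, simplified]
  entries_0[OF words_5_3_def, simplified]

lemma certificate_5_3:
  "coset_certificate 5 3 40 6
    (target [row_5_3_1, row_5_3_2, row_5_3_3, row_5_3_4])
    (weight [row_5_3_1, row_5_3_2, row_5_3_3, row_5_3_4])
    (rank [row_5_3_1, row_5_3_2, row_5_3_3, row_5_3_4]) ((!) words_5_3)"
  by unfold_locales (simp_all add: table_5_3 certificate_simps)

theorem theorem4p1:
  shows "H1_N 3 3 \<cong> free_Abelian_group {..<(4::nat)} \<and>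
         H1_N 3 4 \<cong> free_Abelian_group {..<(6::nat)} \<and>
         H1_N 3 5 \<cong> free_Abelian_group {..<(12::nat)} \<and>
         H1_N 4 3 \<cong> free_Abelian_group {..<(12::nat)} \<and>
         H1_N 5 3 \<cong> free_Abelian_group {..<(40::nat)}"
  using coset_certificate.H1_N_free[OF certificate_3_3]
    coset_certificate.H1_N_free[OF certificate_3_4]
    coset_certificate.H1_N_free[OF certificate_3_5]
    coset_certificate.H1_N_free[OF certificate_4_3]
    coset_certificate.H1_N_free[OF certificate_5_3]
  by blast

end
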